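(* Let $\mathbb{F}$ be an arbitrary field, $d\ge 1$ an integer, and let $E \subset \mathbb{F}^d$ be a finite set of points such that no line contains more than $(3/4)|E|$ points of $E$. Then $$\#\{y \in \mathbb{F}^d : |\pi^y(E)|< 2^{-1}|E|^{1/2}\} \leq 1.$$
   Context: For a field $\mathbb{F}$ and a point $y\in\mathbb{F}^d$, the radial projection $\pi^y$ maps each point $x\neq y$ of $\mathbb{F}^d$ to the (affine) line containing $x$ and $y$. For $E\subset\mathbb{F}^d$, $\pi^y(E)=\{\pi^y(x): x\in E\setminus\{y\}\}$; thus $|\pi^y(E)|$ is the number of lines through $y$ that contain at least one point of $E\setminus\{y\}$. *)

theory Defs
  imports "HOL-Analysis.Cartesian_Space"
begin

definition is_line :: "('a::field ^ 'n) set \<Rightarrow> bool" where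
  "is_line L \<longleftrightarrow> (\<exists>p v. v \<noteq> 0 \<and> L = {p + t *s v | t. True})"

(* Only meaningful for x \<noteq> y; for x = y the value is {y}, which is not a line. *)
definition radial_proj :: "('a::field ^ 'n) \<Rightarrow> 'a ^ 'n \<Rightarrow> ('a ^ 'n) set" where
  "radial_proj y x = {y + t *s (x - y) | t. True}"

lemma radial_proj_unique_line:
  fixes x y :: "'a::field ^ 'n"
  assumes "x \<noteq> y"
  shows "is_line L \<and> x \<in> L \<and> y \<in> L \<longleftrightarrow> L = radial_proj y x"
proof
  assume "is_line L \<and> x \<in> L \<and> y \<in> L"
  then obtain p v a b where v: "v \<noteq> 0" and L: "L = {p + t *s v | t. True}"
    and x: "x = p + a *s v" and y: "y = p + b *s v"
    unfolding is_line_def by blast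
  have ab: "a - b \<noteq> 0" using assms x y by auto
  have xy: "x - y = (a - b) *s v" unfolding x y by (simp add: vec_eq_iff algebra_simps)
  have "p + t *s v \<in> radial_proj y x" for t
  proof -
    have "(t - b) / (a - b) * (a - b) = t - b" using ab by simp
    then have "p + t *s v = y + ((t - b) / (a - b)) *s (x - y)"
      by (simp only: xy vector_smult_assoc) (simp add: y vec_eq_iff left_diff_distrib)
    then show ?thesis unfolding radial_proj_def by blast
  qed
  moreover have "y + t *s (x - y) \<in> L" for t
  proof -
    have "y + t *s (x - y) = p + (b + t * (a - b)) *s v"
      unfolding xy by (simp add: y vec_eq_iff algebra_simps)
    then show ?thesis unfolding L by blast
  qed
  ultimately show "L = radial_proj y x"
    unfolding L radial_proj_def by blast
next
  assume L: "L = radial_proj y x"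
  have "is_line L" unfolding L radial_proj_def is_line_def
    using assms by (intro exI[of _ y] exI[of _ "x - y"]) simp
  moreover have "x = y + 1 *s (x - y)" "y = y + 0 *s (x - y)"
    by (simp_all add: vec_eq_iff)
  then have "x \<in> L" "y \<in> L" unfolding L radial_proj_def by blast+
  ultimately show "is_line L \<and> x \<in> L \<and> y \<in> L" by blast
qed

definition radial_image :: "('a::field ^ 'n) \<Rightarrow> ('a ^ 'n) set \<Rightarrow> ('a ^ 'n) set set" where
  "radial_image y E = radial_proj y ` (E - {y})"

end

theory Submission
  imports Defs
begin

text \<open>
  Two distinct points \<open>y\<close> and \<open>z\<close> act as the centres of a coordinate system: a point off the
  line \<open>yz\<close> is the only common point of the line joining it to \<open>y\<close> and the line joining it to \<open>z\<close>.
  So the part of \<open>E\<close> off the line \<open>yz\<close> has at most as many points as there are pairs of directions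
  seen from \<open>y\<close> and \<open>z\<close> (lemma \<open>card_off_line_le\<close>). By hypothesis this part contains at least a
  quarter of \<open>E\<close>, whereas two points \<open>y\<close> and \<open>z\<close> that both see fewer than half of
  \<open>sqrt (card E)\<close> directions would leave fewer than \<open>card E / 4\<close> pairs.
\<close>

lemma line_eq_radial_proj:
  fixes x y :: "'a::field ^ 'n"
  assumes "is_line L" "x \<in> L" "y \<in> L" "x \<noteq> y"
  shows "L = radial_proj y x"
  using radial_proj_unique_line assms by blast

lemma radial_proj_line:
  fixes x y :: "'a::field ^ 'n"
  assumes "x \<noteq> y"
  shows "is_line (radial_proj y x)" "x \<in> radial_proj y x" "y \<in> radial_proj y x"
  using radial_proj_unique_line[OF assms] by blast+

text \<open>
  If two different points had the same projections from \<open>y\<close> and from \<open>z\<close>, then both projections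
  would be the line through these two points. That line would contain \<open>y\<close> and \<open>z\<close>, so it
  would be the excluded line.
\<close>

lemma inj_on_radial_proj_pair:
  fixes y z :: "'a::field ^ 'n"
  assumes "y \<noteq> z"
  shows "inj_on (\<lambda>x. (radial_proj y x, radial_proj z x)) (- radial_proj y z)"
proof (rule inj_onI)
  fix x x'
  assume x: "x \<in> - radial_proj y z" and x': "x' \<in> - radial_proj y z"
    and eq: "(radial_proj y x, radial_proj z x) = (radial_proj y x', radial_proj z x')"
  have yz: "y \<in> radial_proj y z" "z \<in> radial_proj y z"
    using radial_proj_line[of z y] assms by auto
  then have ne: "x \<noteq> y" "x \<noteq> z" "x' \<noteq> y" "x' \<noteq> z"
    using x x' by auto
  show "x = x'"
  proof (rule ccontr)
    assume "x \<noteq> x'"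
    have "radial_proj y x = radial_proj x' x"
      using line_eq_radial_proj radial_proj_line ne eq \<open>x \<noteq> x'\<close> by (metis Pair_inject)
    moreover have "radial_proj z x = radial_proj x' x"
      using line_eq_radial_proj radial_proj_line ne eq \<open>x \<noteq> x'\<close> by (metis Pair_inject)
    ultimately have "z \<in> radial_proj y x"
      using radial_proj_line(3)[OF ne(2)] by simp
    then have "radial_proj y x = radial_proj y z"
      using line_eq_radial_proj radial_proj_line ne(1) assms by metis
    then show False
      using x radial_proj_line(2)[OF ne(1)] by simp
  qed
qed

lemma card_off_line_le:
  fixes y z :: "'a::field ^ 'n"
  assumes "finite E" "y \<noteq> z"
  shows "card (E - radial_proj y z) \<le> card (radial_image y E) * card (radial_image z E)"
proof -
  have fin: "finite (radial_image w E)" for w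
    unfolding radial_image_def using assms(1) by simp
  have yz: "y \<in> radial_proj y z" "z \<in> radial_proj y z"
    using radial_proj_line[of z y] assms(2) by auto
  have "card (E - radial_proj y z) \<le> card (radial_image y E \<times> radial_image z E)"
  proof (rule card_inj_on_le)
    show "inj_on (\<lambda>x. (radial_proj y x, radial_proj z x)) (E - radial_proj y z)"
      by (rule inj_on_subset[OF inj_on_radial_proj_pair[OF assms(2)]]) auto
    show "(\<lambda>x. (radial_proj y x, radial_proj z x)) ` (E - radial_proj y z)
        \<subseteq> radial_image y E \<times> radial_image z E"
      unfolding radial_image_def using yz by blast
  qed (simp add: fin)
  then show ?thesis by (simp add: card_cartesian_product)
qed

theorem theorem1p7:
  fixes E :: "('a::field ^ 'n) set"
  assumes "finite E"
    and "\<And>L. is_line L \<Longrightarrow> real (card (L \<inter> E)) \<le> (3/4) * real (card E)"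
  shows "finite {y :: 'a ^ 'n. real (card (radial_image y E)) < (1/2) * sqrt (real (card E))}
    \<and> card {y :: 'a ^ 'n. real (card (radial_image y E)) < (1/2) * sqrt (real (card E))} \<le> 1"
proof -
  let ?S = "{y :: 'a ^ 'n. real (card (radial_image y E)) < (1/2) * sqrt (real (card E))}"
  have unique: "y = z" if y: "y \<in> ?S" and z: "z \<in> ?S" for y z
  proof (rule ccontr)
    assume "y \<noteq> z"
    let ?L = "radial_proj y z"
    have "is_line ?L"
      using radial_proj_line(1) \<open>y \<noteq> z\<close> by metis
    then have "real (card (?L \<inter> E)) \<le> (3/4) * real (card E)"
      by (rule assms(2))
    moreover have "card E = card (?L \<inter> E) + card (E - ?L)"
      using card_Int_Diff[OF assms(1), of ?L] by (simp add: Int_commute)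
    ultimately have "real (card E) / 4 \<le> real (card (E - ?L))"
      by simp
    also have "\<dots> \<le> real (card (radial_image y E)) * real (card (radial_image z E))"
      using card_off_line_le[OF assms(1) \<open>y \<noteq> z\<close>] by (metis of_nat_le_iff of_nat_mult)
    also have "\<dots> < ((1/2) * sqrt (real (card E))) * ((1/2) * sqrt (real (card E)))"
      using y z by (intro mult_strict_mono') auto
    also have "\<dots> = real (card E) / 4"
      by simp
    finally show False by simp
  qed
  have "?S = {} \<or> (\<exists>y. ?S = {y})"
    using unique by blast
  then show ?thesis
    by (elim disjE exE) simp_all
qed

end
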